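(* Consider a 3-D linear time-invariant system with impulse response $h\colon\mathbb{R}^3\to\mathbb{R}$, input $u\colon\mathbb{R}^3\to\mathbb{R}$ and output $v\colon\mathbb{R}^3\to\mathbb{R}$, i.e. $v(\mathbf{x})=(u*h)(\mathbf{x})=\int_{\mathbb{R}^3}u(\mathbf{y})\cdot h(\mathbf{x}-\mathbf{y})\,d\mathbf{y}$. Let $U$, $V$ and $H_{\mathrm{OFT}}$ be the octonion Fourier transforms of $u$, $v$ and $h$. Then for all $\mathbf{f}\in\mathbb{R}^3$ $$V(\mathbf{f})=H_{\mathrm{OFT}}(\mathbf{f})\odot U(\mathbf{f}),$$ where $\odot$ is the multiplication of the algebra $\mathbb{F}$ of quadruple-complex numbers.
   Context: $\mathbb{O}$ denotes the real algebra of octonions with basis $1,\mathbf{e}_1,\dots,\mathbf{e}_7$: an octonion is a pair $(q_0,q_1)$ of quaternions (quaternion units $\mathbf{e}_1,\mathbf{e}_2,\mathbf{e}_3$ with $\mathbf{e}_1\mathbf{e}_2=\mathbf{e}_3$), with product $(q_0,q_1)\cdot(p_0,p_1)=(q_0p_0-p_1^*q_1,\;p_1q_0+q_1p_0^* )$, where $^*$ is quaternion conjugation, and $\mathbf{e}_4=(0,1)$, $\mathbf{e}_5=(0,\mathbf{e}_1)$, $\mathbf{e}_6=(0,\mathbf{e}_2)$, $\mathbf{e}_7=(0,\mathbf{e}_3)$. The product is neither commutative nor associative; products without brackets are evaluated from left to right, i.e. $abcd=((ab)c)d$. For an imaginary unit $\mathbf{e}_k$ and $\alpha\in\mathbb{R}$,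 $e^{\mathbf{e}_k\alpha}=\cos\alpha+\mathbf{e}_k\sin\alpha$. Integrals of octonion-valued functions are taken componentwise. The octonion Fourier transform (OFT) of a Lebesgue integrable $u\colon\mathbb{R}^3\to\mathbb{O}$ is $$U(\mathbf{f})=\int_{\mathbb{R}^3}u(\mathbf{x})\,e^{-\mathbf{e}_1 2\pi f_1x_1}\,e^{-\mathbf{e}_2 2\pi f_2x_2}\,e^{-\mathbf{e}_4 2\pi f_3x_3}\,d\mathbf{x},\qquad \mathbf{f}=(f_1,f_2,f_3)\in\mathbb{R}^3,$$ with multiplication from left to right. The algebra $\mathbb{F}$ of quadruple-complex numbers has the same underlying real vector space with basis $1,\mathbf{e}_1,\dots,\mathbf{e}_7$; an element $p=p_0+p_1\mathbf{e}_1+\dots+p_7\mathbf{e}_7$ is identified with the quadruple of complex numbers $(s_0,s_1,s_2,s_3)$, $s_0=p_0+p_1\mathbf{e}_1$, $s_1=p_2+p_3\mathbf{e}_1$, $s_2=p_4+p_5\mathbf{e}_1$, $s_3=p_6+p_7\mathbf{e}_1$ (with $\mathbf{e}_1$ as the complex imaginary unit), and thereby with the octonion having the same coordinates. Multiplication in $\mathbb{F}$ is $$(s_0,s_1,s_2,s_3)\odot(t_0,t_1,t_2,t_3)=(s_0t_0-s_1t_1-s_2t_2+s_3t_3,\ s_0t_1+s_1t_0-s_2t_3-s_3t_2,\ s_0t_2+s_2t_0-s_1t_3-s_3t_1,\ s_0t_3+s_3t_0+s_1t_2+s_2t_1).$$ Standing assumption: $u$ and $h$ are Lebesgue integrable,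 so that the OFTs are well defined. *)

theory Defs
  imports "HOL-Analysis.Analysis"
begin

section \<open>Quaternions\<close>

datatype quaternion =
  Quaternion (quat_re: real) (quat_i: real) (quat_j: real) (quat_k: real)

lemma quaternion_eq_iff:
  "p = q \<longleftrightarrow> quat_re p = quat_re q \<and> quat_i p = quat_i q \<and> quat_j p = quat_j q \<and> quat_k p = quat_k q"
  by (auto intro: quaternion.expand)

instantiation quaternion :: ring_1
begin

definition "0 = Quaternion 0 0 0 0"
definition "1 = Quaternion 1 0 0 0"
definition "- p = Quaternion (- quat_re p) (- quat_i p) (- quat_j p) (- quat_k p)"
definition "p + q = Quaternion (quat_re p + quat_re q) (quat_i p + quat_i q)
  (quat_j p + quat_j q) (quat_k p + quat_k q)"
definition "p - q = Quaternion (quat_re p - quat_re q) (quat_i p - quat_i q)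
  (quat_j p - quat_j q) (quat_k p - quat_k q)"
definition "p * q = Quaternion
  (quat_re p * quat_re q - quat_i p * quat_i q - quat_j p * quat_j q - quat_k p * quat_k q)
  (quat_re p * quat_i q + quat_i p * quat_re q + quat_j p * quat_k q - quat_k p * quat_j q)
  (quat_re p * quat_j q - quat_i p * quat_k q + quat_j p * quat_re q + quat_k p * quat_i q)
  (quat_re p * quat_k q + quat_i p * quat_j q - quat_j p * quat_i q + quat_k p * quat_re q)"

instance
  by intro_classes
    (simp_all add: quaternion_eq_iff zero_quaternion_def one_quaternion_def uminus_quaternion_def
      plus_quaternion_def minus_quaternion_def times_quaternion_def algebra_simps)

end

instantiation quaternion :: real_algebra_1
begin

definition "r *\<^sub>R p = Quaternion (r * quat_re p) (r * quat_i p) (r * quat_j p) (r * quat_k p)"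

instance
  by intro_classes
    (simp_all add: quaternion_eq_iff scaleR_quaternion_def plus_quaternion_def
      times_quaternion_def algebra_simps)

end

definition quat_cnj :: "quaternion \<Rightarrow> quaternion" where
  "quat_cnj q = Quaternion (quat_re q) (- quat_i q) (- quat_j q) (- quat_k q)"


section \<open>Octonions\<close>

datatype octonion = Octonion (oct_fst: quaternion) (oct_snd: quaternion)

lemma octonion_eq_iff: "p = q \<longleftrightarrow> oct_fst p = oct_fst q \<and> oct_snd p = oct_snd q"
  by (auto intro: octonion.expand)

instantiation octonion :: real_vector
begin

definition "0 = Octonion 0 0"
definition "- p = Octonion (- oct_fst p) (- oct_snd p)"
definition "p + q = Octonion (oct_fst p + oct_fst q) (oct_snd p + oct_snd q)"
definition "p - q = Octonion (oct_fst p - oct_fst q) (oct_snd p - oct_snd q)"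
definition "r *\<^sub>R p = Octonion (r *\<^sub>R oct_fst p) (r *\<^sub>R oct_snd p)"

instance
  by intro_classes
    (simp_all add: octonion_eq_iff zero_octonion_def uminus_octonion_def plus_octonion_def
      minus_octonion_def scaleR_octonion_def algebra_simps)

end

text \<open>
  The product is not associative, so only the syntactic classes are instantiated. Since
  \<open>*\<close> associates to the left, an unbracketed product is evaluated from left to right.
\<close>

instantiation octonion :: "{one, times}"
begin

definition "1 = Octonion 1 0"
definition "p * q = Octonion
  (oct_fst p * oct_fst q - quat_cnj (oct_snd q) * oct_snd p)
  (oct_snd q * oct_fst p + oct_snd p * quat_cnj (oct_fst q))"

instance ..

end

definition oct_of_real :: "real \<Rightarrow> octonion" where
  "oct_of_real r = r *\<^sub>R 1"

definition oct_e1 :: octonion where "oct_e1 = Octonion (Quaternion 0 1 0 0) 0"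
definition oct_e2 :: octonion where "oct_e2 = Octonion (Quaternion 0 0 1 0) 0"
definition oct_e4 :: octonion where "oct_e4 = Octonion 0 1"

text \<open>For an imaginary unit \<open>e\<close>, this is the exponential of \<open>e\<close> times \<open>\<alpha>\<close>.\<close>

definition oct_exp :: "octonion \<Rightarrow> real \<Rightarrow> octonion" where
  "oct_exp e \<alpha> = oct_of_real (cos \<alpha>) + sin \<alpha> *\<^sub>R e"


section \<open>The octonion Fourier transform\<close>

definition oct_integral :: "'a measure \<Rightarrow> ('a \<Rightarrow> octonion) \<Rightarrow> octonion" where
  "oct_integral M g = Octonion
    (Quaternion (LINT x|M. quat_re (oct_fst (g x))) (LINT x|M. quat_i (oct_fst (g x)))
                (LINT x|M. quat_j (oct_fst (g x))) (LINT x|M. quat_k (oct_fst (g x))))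
    (Quaternion (LINT x|M. quat_re (oct_snd (g x))) (LINT x|M. quat_i (oct_snd (g x)))
                (LINT x|M. quat_j (oct_snd (g x))) (LINT x|M. quat_k (oct_snd (g x))))"

definition OFT :: "(real^3 \<Rightarrow> octonion) \<Rightarrow> real^3 \<Rightarrow> octonion" where
  "OFT u f = oct_integral lebesgue (\<lambda>x. u x
      * oct_exp oct_e1 (- (2 * pi * f$1 * x$1))
      * oct_exp oct_e2 (- (2 * pi * f$2 * x$2))
      * oct_exp oct_e4 (- (2 * pi * f$3 * x$3)))"


section \<open>Quadruple-complex numbers\<close>

text \<open>
  The algebra shares its underlying space with the octonions. Its multiplication is given on
  quadruples of complex numbers, obtained by pairing consecutive coordinates.
\<close>

definition quad_of_oct :: "octonion \<Rightarrow> complex \<times> complex \<times> complex \<times> complex" where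
  "quad_of_oct p =
    (Complex (quat_re (oct_fst p)) (quat_i (oct_fst p)),
     Complex (quat_j (oct_fst p)) (quat_k (oct_fst p)),
     Complex (quat_re (oct_snd p)) (quat_i (oct_snd p)),
     Complex (quat_j (oct_snd p)) (quat_k (oct_snd p)))"

definition oct_of_quad :: "complex \<times> complex \<times> complex \<times> complex \<Rightarrow> octonion" where
  "oct_of_quad = (\<lambda>(s0, s1, s2, s3). Octonion
    (Quaternion (Re s0) (Im s0) (Re s1) (Im s1))
    (Quaternion (Re s2) (Im s2) (Re s3) (Im s3)))"

definition quad_mult ::
  "complex \<times> complex \<times> complex \<times> complex \<Rightarrow> complex \<times> complex \<times> complex \<times> complex
    \<Rightarrow> complex \<times> complex \<times> complex \<times> complex" where
  "quad_mult = (\<lambda>(s0, s1, s2, s3) (t0, t1, t2, t3).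
    (s0 * t0 - s1 * t1 - s2 * t2 + s3 * t3,
     s0 * t1 + s1 * t0 - s2 * t3 - s3 * t2,
     s0 * t2 + s2 * t0 - s1 * t3 - s3 * t1,
     s0 * t3 + s3 * t0 + s1 * t2 + s2 * t1))"

definition F_mult :: "octonion \<Rightarrow> octonion \<Rightarrow> octonion" (infixl "\<odot>" 70) where
  "p \<odot> q = oct_of_quad (quad_mult (quad_of_oct p) (quad_of_oct q))"

end

theory Submission
  imports Defs
begin

text \<open>
  The quadruple-complex algebra \<open>F\<close> is isomorphic, as an algebra over \<open>\<complex>\<close> with imaginary unit
  \<open>e\<^sub>1\<close>, to \<open>\<complex>\<^sup>4\<close>: it is commutative and generated by two further square roots
  of \<open>-1\<close>, the images of \<open>e\<^sub>2\<close> and \<open>e\<^sub>4\<close>. Choosing complex square roots \<open>w\<close>, \<open>z\<close> of \<open>-1\<close>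
  as their values gives an algebra homomorphism to \<open>\<complex>\<close>
  (\<open>quad_char\<close>, \<open>quad_char_mult\<close>), and the four choices together separate points
  (\<open>quad_char_eqI\<close>). It is therefore enough to compare the images of both sides of the
  claimed identity under these four homomorphisms.

  For a real signal the integrand of the octonion Fourier transform is the signal times
  a fixed kernel, whose eight coordinates are the products of one of the functions \<open>cos\<close>,
  \<open>sin\<close> in each of the three phases (\<open>OFT_integrand\<close>). A homomorphism \<open>quad_char w z\<close> turns
  this kernel into
  \<open>cis a * (cos b + w * sin b) * (cos c + z * sin c)\<close>, which is a bounded multiplicative
  character of the additive group \<open>\<real>\<^sup>3\<close> since \<open>w\<^sup>2 = z\<^sup>2 = -1\<close> (\<open>kernel_char_add\<close>); in fact it is
  an ordinary complex exponential, with the signs of the last two frequencies depending on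
  \<open>w\<close> and \<open>z\<close>. So each homomorphism maps the octonion transform to a classical
  transform (\<open>quad_char_OFT\<close>), for which the classical convolution theorem
  (\<open>convolution_character\<close>) turns convolution into multiplication.
\<close>

section \<open>Convolution and bounded characters\<close>

lemma lborel_distr_reflection:
  fixes a :: "'a::euclidean_space"
  shows "distr lborel borel (\<lambda>y. a - y) = lborel"
  by (subst lborel_affine[of "-1" a]) (auto simp: density_1 one_ennreal_def[symmetric])

lemma reflection_measurable_lebesgue:
  fixes a :: "'a::euclidean_space"
  shows "(\<lambda>y. a - y) \<in> lebesgue \<rightarrow>\<^sub>M lebesgue"
  using lebesgue_affine_measurable[of "\<lambda>_. -1" a]
  by (simp add: sum_negf euclidean_representation)

lemma lborel_distr_minus:
  fixes a :: "'a::euclidean_space"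
  shows "distr lborel borel (\<lambda>x. x - a) = lborel"
proof -
  have "(\<lambda>x. x - a) = (+) (- a)" by auto
  then show ?thesis using lborel_distr_plus[of "- a"] by simp
qed

lemma lborel_integral_minus:
  fixes a :: "'a::euclidean_space" and g :: "'a \<Rightarrow> 'b::{banach, second_countable_topology}"
  assumes [measurable]: "g \<in> borel_measurable borel"
  shows "(LINT x|lborel. g (x - a)) = (LINT x|lborel. g x)"
  by (subst (2) lborel_distr_minus[of a, symmetric]) (simp add: integral_distr)

lemma lborel_integrable_minus:
  fixes a :: "'a::euclidean_space" and g :: "'a \<Rightarrow> 'b::{banach, second_countable_topology}"
  assumes "integrable lborel g"
  shows "integrable lborel (\<lambda>x. g (x - a))"
proof (rule integrable_distr[where M' = borel and T = "\<lambda>x. x - a"])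
  show "integrable (distr lborel borel (\<lambda>x. x - a)) g"
    using assms by (simp only: lborel_distr_minus)
qed simp

lemma integrable_mult_bounded:
  fixes u :: "'a \<Rightarrow> real" and g :: "'a \<Rightarrow> 'b::{banach, second_countable_topology}"
  assumes u: "integrable M u" and g [measurable]: "g \<in> borel_measurable M"
    and bound: "\<And>x. norm (g x) \<le> B"
  shows "integrable M (\<lambda>x. u x *\<^sub>R g x)"
proof (rule Bochner_Integration.integrable_bound[where f = "\<lambda>x. B * u x"])
  have [measurable]: "u \<in> borel_measurable M" using u by simp
  show "(\<lambda>x. u x *\<^sub>R g x) \<in> borel_measurable M" by simp
  have "norm (u x *\<^sub>R g x) \<le> norm (B * u x)" for x
  proof -
    have "norm (g x) \<le> \<bar>B\<bar>" using bound[of x] by linarith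
    then have "\<bar>u x\<bar> * norm (g x) \<le> \<bar>u x\<bar> * \<bar>B\<bar>" by (rule mult_left_mono) simp
    then show ?thesis by (simp add: abs_mult mult.commute)
  qed
  then show "AE x in M. norm (u x *\<^sub>R g x) \<le> norm (B * u x)" by simp
qed (use u in simp)

text \<open>
  Tonelli with the order of integration in which the inner integral over \<open>x\<close> is, by
  translation invariance, the constant \<open>\<bar>u y\<bar>\<close> times the \<open>L\<^sup>1\<close> norm of \<open>h\<close>.
\<close>

lemma integrable_convolution_integrand:
  fixes u h :: "'a::euclidean_space \<Rightarrow> real"
  assumes u: "integrable lborel u" and h: "integrable lborel h"
  shows "integrable (lborel \<Otimes>\<^sub>M lborel) (\<lambda>(y, x). u y * h (x - y))"
proof (rule lborel_pair.Fubini_integrable)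
  have [measurable]: "u \<in> borel_measurable borel" "h \<in> borel_measurable borel"
    using u h by simp_all
  show "(\<lambda>(y, x). u y * h (x - y)) \<in> borel_measurable (lborel \<Otimes>\<^sub>M lborel)"
    by measurable
  have "(LINT x|lborel. norm (case (y, x) of (y, x) \<Rightarrow> u y * h (x - y)))
      = \<bar>u y\<bar> * (LINT x|lborel. \<bar>h x\<bar>)" for y
    using lborel_integral_minus[of "\<lambda>x. \<bar>h x\<bar>" y] by (simp add: abs_mult)
  then show "integrable lborel
      (\<lambda>y. LINT x|lborel. norm (case (y, x) of (y, x) \<Rightarrow> u y * h (x - y)))"
    using u by simp
  show "AE y in lborel. integrable lborel (\<lambda>x. case (y, x) of (y, x) \<Rightarrow> u y * h (x - y))"
    using lborel_integrable_minus[OF h] by simp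
qed

text \<open>
  Fubini and the substitution \<open>x \<mapsto> x + y\<close> reduce the double integral to one in which
  \<open>\<phi> (x + y) = \<phi> x * \<phi> y\<close> separates the variables. Borel measurability matters here: it makes
  the integrand measurable for the product of the two Borel \<open>\<sigma>\<close>-algebras.
\<close>

lemma lborel_convolution_character:
  fixes u h :: "'a::euclidean_space \<Rightarrow> real" and \<phi> :: "'a \<Rightarrow> complex"
  assumes u: "integrable lborel u" and h: "integrable lborel h"
    and \<phi> [measurable]: "\<phi> \<in> borel_measurable borel"
    and bound: "\<And>x. norm (\<phi> x) \<le> B"
    and hom: "\<And>x y. \<phi> (x + y) = \<phi> x * \<phi> y"
  shows "integrable lborel (\<lambda>x. LINT y|lborel. u y * h (x - y))"
    and "(LINT x|lborel. (LINT y|lborel. u y * h (x - y)) *\<^sub>R \<phi> x)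
      = (LINT x|lborel. h x *\<^sub>R \<phi> x) * (LINT x|lborel. u x *\<^sub>R \<phi> x)"
proof -
  have [measurable]: "u \<in> borel_measurable borel" "h \<in> borel_measurable borel"
    using u h by simp_all
  note uh = integrable_convolution_integrand[OF u h]
  show "integrable lborel (\<lambda>x. LINT y|lborel. u y * h (x - y))"
    using lborel_pair.integrable_snd[OF uh] .
  have "integrable (lborel \<Otimes>\<^sub>M lborel)
      (\<lambda>p. (case p of (y, x) \<Rightarrow> u y * h (x - y)) *\<^sub>R (\<phi> (snd p)))"
    by (rule integrable_mult_bounded[OF uh _ bound]) measurable
  then have uh\<phi>: "integrable (lborel \<Otimes>\<^sub>M lborel) (\<lambda>(y, x). (u y * h (x - y)) *\<^sub>R \<phi> x)"
    by (simp add: case_prod_beta')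
  have "(LINT x|lborel. (LINT y|lborel. u y * h (x - y)) *\<^sub>R \<phi> x)
      = (LINT x|lborel. LINT y|lborel. (u y * h (x - y)) *\<^sub>R \<phi> x)"
  proof (rule integral_cong_AE)
    \<comment> \<open>Only almost every fibre is integrable; on the others the Bochner integral is \<open>0\<close> by default.\<close>
    show "AE x in lborel. (LINT y|lborel. u y * h (x - y)) *\<^sub>R \<phi> x
        = (LINT y|lborel. (u y * h (x - y)) *\<^sub>R \<phi> x)"
      using lborel_pair.AE_integrable_snd[OF uh]
    proof eventually_elim
      case (elim x)
      then show ?case by simp
    qed
  qed measurable
  also have "\<dots> = (LINT y|lborel. LINT x|lborel. (u y * h (x - y)) *\<^sub>R \<phi> x)"
    by (rule lborel_pair.Fubini_integral[OF uh\<phi>])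
  also have "\<dots> = (LINT y|lborel. (LINT x|lborel. h x *\<^sub>R \<phi> x) * (u y *\<^sub>R \<phi> y))"
  proof (intro Bochner_Integration.integral_cong refl)
    fix y :: 'a
    have "(LINT x|lborel. (u y * h (x - y)) *\<^sub>R \<phi> x)
        = (LINT x|lborel. (u y * h x) *\<^sub>R \<phi> (x + y))"
      using lborel_integral_minus[of "\<lambda>x. (u y * h x) *\<^sub>R \<phi> (x + y)" y] by simp
    also have "\<dots> = (LINT x|lborel. (h x *\<^sub>R \<phi> x) * (u y *\<^sub>R \<phi> y))"
      by (simp add: hom mult_ac)
    also have "\<dots> = (LINT x|lborel. h x *\<^sub>R \<phi> x) * (u y *\<^sub>R \<phi> y)"
      by (rule integral_mult_left_zero)
    finally show "(LINT x|lborel. (u y * h (x - y)) *\<^sub>R \<phi> x)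
        = (LINT x|lborel. h x *\<^sub>R \<phi> x) * (u y *\<^sub>R \<phi> y)" .
  qed
  also have "\<dots> = (LINT x|lborel. h x *\<^sub>R \<phi> x) * (LINT x|lborel. u x *\<^sub>R \<phi> x)"
    by (rule integral_mult_right_zero)
  finally show "(LINT x|lborel. (LINT y|lborel. u y * h (x - y)) *\<^sub>R \<phi> x)
      = (LINT x|lborel. h x *\<^sub>R \<phi> x) * (LINT x|lborel. u x *\<^sub>R \<phi> x)" .
qed

lemma borel_representative:
  fixes u :: "'a::euclidean_space \<Rightarrow> real"
  assumes "integrable lebesgue u"
  obtains u' where "integrable lborel u'" "AE x in lborel. u x = u' x"
proof -
  have meas: "u \<in> borel_measurable lebesgue" using assms by simp
  obtain u' where u': "u' \<in> borel_measurable lborel" and eq: "AE x in lborel. u x = u' x"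
    using completion_ex_borel_measurable_real[OF meas] by blast
  have "integrable lebesgue u'"
    by (rule integrable_cong_AE_imp[OF assms])
      (use u' AE_completion[OF eq] in \<open>auto intro: measurable_completion\<close>)
  then show thesis using u' eq that by (simp add: integrable_completion)
qed

lemma lebesgue_integral_eq_lborel:
  fixes f g :: "'a::euclidean_space \<Rightarrow> 'b::{banach, second_countable_topology}"
  assumes "f \<in> borel_measurable lebesgue" and "g \<in> borel_measurable lborel"
    and "AE x in lborel. f x = g x"
  shows "integral\<^sup>L lebesgue f = integral\<^sup>L lborel g"
proof -
  have "integral\<^sup>L lebesgue f = integral\<^sup>L lebesgue g"
    using assms by (intro integral_cong_AE) (auto intro: AE_completion measurable_completion)
  then show ?thesis using assms by (simp add: integral_completion)
qed

lemma AE_lborel_reflection: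
  fixes a :: "'a::euclidean_space"
  assumes "AE y in lborel. P y"
  shows "AE y in lborel. P (a - y)"
proof (rule AE_distrD[where M' = borel and f = "\<lambda>y. a - y"])
  show "(\<lambda>y. a - y) \<in> lborel \<rightarrow>\<^sub>M borel" by simp
  show "AE y in distr lborel borel (\<lambda>y. a - y). P y"
    using assms by (simp only: lborel_distr_reflection)
qed

text \<open>
  Reduction of Lebesgue measurable functions to Borel ones. Changing \<open>u\<close> and \<open>h\<close> on null sets
  changes the integrand of the convolution at each \<open>x\<close> only on a null set, because
  \<open>y \<mapsto> x - y\<close> preserves null sets. Hence the convolution itself is unchanged at every
  point.
\<close>

lemma convolution_character:
  fixes u h :: "'a::euclidean_space \<Rightarrow> real" and \<phi> :: "'a \<Rightarrow> complex"
  assumes u: "integrable lebesgue u" and h: "integrable lebesgue h"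
    and \<phi> [measurable]: "\<phi> \<in> borel_measurable borel"
    and bound: "\<And>x. norm (\<phi> x) \<le> B"
    and hom: "\<And>x y. \<phi> (x + y) = \<phi> x * \<phi> y"
  shows "integrable lebesgue (\<lambda>x. LINT y|lebesgue. u y * h (x - y))"
    and "(LINT x|lebesgue. (LINT y|lebesgue. u y * h (x - y)) *\<^sub>R \<phi> x)
      = (LINT x|lebesgue. h x *\<^sub>R \<phi> x) * (LINT x|lebesgue. u x *\<^sub>R \<phi> x)"
proof -
  obtain u' where u': "integrable lborel u'" and uu': "AE x in lborel. u x = u' x"
    using borel_representative[OF u] .
  obtain h' where h': "integrable lborel h'" and hh': "AE x in lborel. h x = h' x"
    using borel_representative[OF h] .
  have [measurable]: "u' \<in> borel_measurable borel" "h' \<in> borel_measurable borel"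
    using u' h' by simp_all
  have [measurable]: "u \<in> borel_measurable lebesgue" "h \<in> borel_measurable lebesgue"
    using u h by simp_all
  have \<phi>_leb [measurable]: "\<phi> \<in> borel_measurable lebesgue"
    by (rule measurable_completion) simp
  have conv: "(LINT y|lebesgue. u y * h (x - y)) = (LINT y|lborel. u' y * h' (x - y))" for x
  proof -
    have eq: "AE y in lborel. u y * h (x - y) = u' y * h' (x - y)"
      using uu' AE_lborel_reflection[OF hh', of x] by eventually_elim simp
    have meas: "(\<lambda>y. u' y * h' (x - y)) \<in> borel_measurable lborel" by simp
    have "(\<lambda>y. u y * h (x - y)) \<in> borel_measurable lebesgue"
      using measurable_compose[OF reflection_measurable_lebesgue \<open>h \<in> borel_measurable lebesgue\<close>, of x]
      by simp
    then show ?thesis using meas eq by (rule lebesgue_integral_eq_lborel)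
  qed
  note main = lborel_convolution_character[OF u' h' \<phi> bound hom]
  show "integrable lebesgue (\<lambda>x. LINT y|lebesgue. u y * h (x - y))"
    using main(1) by (simp add: conv integrable_completion)
  have *: "(LINT x|lebesgue. w x *\<^sub>R \<phi> x) = (LINT x|lborel. w' x *\<^sub>R \<phi> x)"
    if "integrable lebesgue w" "integrable lborel w'" "AE x in lborel. w x = w' x"
    for w w' :: "'a \<Rightarrow> real"
  proof (rule lebesgue_integral_eq_lborel)
    have [measurable]: "w \<in> borel_measurable lebesgue" "w' \<in> borel_measurable borel"
      using that by simp_all
    show "(\<lambda>x. w x *\<^sub>R \<phi> x) \<in> borel_measurable lebesgue"
      "(\<lambda>x. w' x *\<^sub>R \<phi> x) \<in> borel_measurable lborel" by simp_all
    show "AE x in lborel. w x *\<^sub>R \<phi> x = w' x *\<^sub>R \<phi> x"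
      using that(3) by eventually_elim simp
  qed
  have "(LINT x|lebesgue. (LINT y|lborel. u' y * h' (x - y)) *\<^sub>R \<phi> x)
      = (LINT x|lborel. (LINT y|lborel. u' y * h' (x - y)) *\<^sub>R \<phi> x)"
    using main(1) by (intro *) (simp_all add: integrable_completion)
  then show "(LINT x|lebesgue. (LINT y|lebesgue. u y * h (x - y)) *\<^sub>R \<phi> x)
      = (LINT x|lebesgue. h x *\<^sub>R \<phi> x) * (LINT x|lebesgue. u x *\<^sub>R \<phi> x)"
    using main(2) by (simp add: conv *[OF u u' uu'] *[OF h h' hh'])
qed

section \<open>The four complex characters of the quadruple-complex algebra\<close>

text \<open>
  The candidate homomorphism \<open>F \<rightarrow> \<complex>\<close> with \<open>e\<^sub>1 \<mapsto> \<i>\<close>, \<open>e\<^sub>2 \<mapsto> w\<close>, \<open>e\<^sub>4 \<mapsto> z\<close>. The last coordinate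
  gets the factor \<open>w * z\<close> because \<open>e\<^sub>6\<close> is the product of \<open>e\<^sub>2\<close> and \<open>e\<^sub>4\<close> in \<open>F\<close>.
\<close>

definition quad_char :: "complex \<Rightarrow> complex \<Rightarrow> octonion \<Rightarrow> complex" where
  "quad_char w z p = (case quad_of_oct p of (s0, s1, s2, s3) \<Rightarrow> s0 + w * s1 + z * s2 + w * z * s3)"

lemma quad_of_oct_of_quad: "quad_of_oct (oct_of_quad s) = s"
  by (simp add: quad_of_oct_def oct_of_quad_def split: prod.split)

text \<open>
  The signs in the multiplication table of \<open>F\<close> are those of the products of \<open>1, w, z, w * z\<close>;
  the positive sign of \<open>s\<^sub>3 t\<^sub>3\<close> is \<open>(w * z)\<^sup>2 = 1\<close>.
\<close>

lemma quad_char_mult: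
  assumes w: "w * w = -1" and z: "z * z = -1"
  shows "quad_char w z (p \<odot> q) = quad_char w z p * quad_char w z q"
proof -
  have w': "w * (w * a) = - a" and z': "z * (z * a) = - a" for a
    using w z by (simp_all flip: mult.assoc)
  obtain s0 s1 s2 s3 where s: "quad_of_oct p = (s0, s1, s2, s3)" by (metis prod_cases4)
  obtain t0 t1 t2 t3 where t: "quad_of_oct q = (t0, t1, t2, t3)" by (metis prod_cases4)
  have "quad_of_oct (p \<odot> q) = quad_mult (s0, s1, s2, s3) (t0, t1, t2, t3)"
    by (simp add: F_mult_def s t quad_of_oct_of_quad)
  then show ?thesis
    by (simp add: quad_char_def s t quad_mult_def algebra_simps w' z' w z)
qed

text \<open>
  The four values are obtained from the coordinates \<open>s\<^sub>0, \<dots>, s\<^sub>3\<close> by a Hadamard matrix, up to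
  nonzero factors on the coordinates, and this matrix is invertible.
\<close>

lemma quad_char_eqI:
  assumes eq: "\<And>w z. w \<in> {\<i>, -\<i>} \<Longrightarrow> z \<in> {\<i>, -\<i>} \<Longrightarrow> quad_char w z p = quad_char w z q"
  shows "p = q"
proof -
  obtain s0 s1 s2 s3 where s: "quad_of_oct p = (s0, s1, s2, s3)" by (metis prod_cases4)
  obtain t0 t1 t2 t3 where t: "quad_of_oct q = (t0, t1, t2, t3)" by (metis prod_cases4)
  have "s0 = t0 \<and> s1 = t1 \<and> s2 = t2 \<and> s3 = t3"
    using eq[of \<i> \<i>] eq[of \<i> "-\<i>"] eq[of "-\<i>" \<i>] eq[of "-\<i>" "-\<i>"]
    by (simp add: quad_char_def s t complex_eq_iff)
  then have "quad_of_oct p = quad_of_oct q" by (simp add: s t)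
  then show ?thesis
    by (auto simp: quad_of_oct_def octonion_eq_iff quaternion_eq_iff)
qed

section \<open>The kernel of the octonion Fourier transform\<close>

definition OFT_kernel :: "real^3 \<Rightarrow> real^3 \<Rightarrow> octonion" where
  "OFT_kernel f x = oct_of_quad (let
      a = - (2 * pi * f$1 * x$1); b = - (2 * pi * f$2 * x$2); c = - (2 * pi * f$3 * x$3)
    in ((cos b * cos c) *\<^sub>R cis a, (sin b * cos c) *\<^sub>R cis a,
        (cos b * sin c) *\<^sub>R cis a, (sin b * sin c) *\<^sub>R cis a))"

lemmas oct_arith_defs = octonion_eq_iff quaternion_eq_iff
  zero_quaternion_def one_quaternion_def uminus_quaternion_def plus_quaternion_def
  minus_quaternion_def times_quaternion_def scaleR_quaternion_def quat_cnj_def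
  zero_octonion_def one_octonion_def plus_octonion_def scaleR_octonion_def times_octonion_def

text \<open>
  The left factor is a real multiple of \<open>1\<close>, so the three exponentials multiply up as
  \<open>(e\<^sub>1-part * e\<^sub>2-part) * e\<^sub>4-part\<close>. The first product is a quaternion, and multiplying it by
  \<open>cos c + e\<^sub>4 sin c\<close> merely places \<open>cos c\<close> and \<open>sin c\<close> times it into the two halves.
\<close>

lemma OFT_integrand:
  "oct_of_real r * oct_exp oct_e1 (- (2 * pi * f$1 * x$1))
     * oct_exp oct_e2 (- (2 * pi * f$2 * x$2)) * oct_exp oct_e4 (- (2 * pi * f$3 * x$3))
   = r *\<^sub>R OFT_kernel f x"
  by (simp del: cos_minus sin_minus add: OFT_kernel_def oct_of_real_def oct_exp_def
      oct_e1_def oct_e2_def oct_e4_def oct_of_quad_def Let_def oct_arith_defs)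

definition kernel_char :: "complex \<Rightarrow> complex \<Rightarrow> real^3 \<Rightarrow> real^3 \<Rightarrow> complex" where
  "kernel_char w z f x = quad_char w z (OFT_kernel f x)"

lemma kernel_char_eq:
  "kernel_char w z f x = cis (- (2 * pi * f$1 * x$1))
    * (complex_of_real (cos (- (2 * pi * f$2 * x$2))) + w * of_real (sin (- (2 * pi * f$2 * x$2))))
    * (complex_of_real (cos (- (2 * pi * f$3 * x$3))) + z * of_real (sin (- (2 * pi * f$3 * x$3))))"
  by (simp del: cos_minus sin_minus add: kernel_char_def quad_char_def OFT_kernel_def Let_def
      oct_of_quad_def quad_of_oct_def complex_eq_iff algebra_simps)

text \<open>
  The functional equation of the exponential follows from the addition theorems using only
  \<open>w\<^sup>2 = -1\<close>, so the cases \<open>w = \<i>\<close> and \<open>w = -\<i>\<close> need not be distinguished.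
\<close>

lemma cos_plus_root_sin_add:
  assumes w: "(w::complex) * w = -1"
  shows "complex_of_real (cos (a + b)) + w * of_real (sin (a + b))
    = (of_real (cos a) + w * of_real (sin a)) * (of_real (cos b) + w * of_real (sin b))"
proof -
  have w': "w * (w * c) = - c" for c using w by (simp flip: mult.assoc)
  show ?thesis by (simp add: cos_add sin_add algebra_simps w')
qed

lemma kernel_char_add:
  assumes w: "w * w = -1" and z: "z * z = -1"
  shows "kernel_char w z f (x + y) = kernel_char w z f x * kernel_char w z f y"
proof -
  have d: "- (2 * pi * s * (a + b)) = - (2 * pi * s * a) + - (2 * pi * s * b)" for s a b :: real
    by (simp add: algebra_simps)
  show ?thesis
    unfolding kernel_char_eq vector_add_component d
      cos_plus_root_sin_add[OF w] cos_plus_root_sin_add[OF z] cis_mult[symmetric]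
    by (simp only: mult_ac)
qed

lemma norm_kernel_char_le: "norm (kernel_char w z f x) \<le> (1 + norm w) * (1 + norm z)"
proof -
  have b: "norm (complex_of_real (cos a) + w * complex_of_real (sin a)) \<le> 1 + norm w" for a w
  proof (rule order_trans[OF norm_triangle_ineq add_mono])
    show "norm (w * complex_of_real (sin a)) \<le> norm w"
      by (simp add: norm_mult mult_left_le)
  qed simp
  show ?thesis
    unfolding kernel_char_eq norm_mult
    by (simp del: cos_minus sin_minus add: mult_mono b)
qed

lemma borel_kernel_char: "kernel_char w z f \<in> borel_measurable borel"
  unfolding kernel_char_eq[abs_def]
  by (intro borel_measurable_continuous_onI continuous_intros)

lemma quad_char_integral:
  assumes "integrable M (\<lambda>x. quat_re (oct_fst (g x)))" "integrable M (\<lambda>x. quat_i (oct_fst (g x)))"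
    "integrable M (\<lambda>x. quat_j (oct_fst (g x)))" "integrable M (\<lambda>x. quat_k (oct_fst (g x)))"
    "integrable M (\<lambda>x. quat_re (oct_snd (g x)))" "integrable M (\<lambda>x. quat_i (oct_snd (g x)))"
    "integrable M (\<lambda>x. quat_j (oct_snd (g x)))" "integrable M (\<lambda>x. quat_k (oct_snd (g x)))"
  shows "quad_char w z (oct_integral M g) = (LINT x|M. quad_char w z (g x))"
  using assms by (simp add: quad_char_def quad_of_oct_def oct_integral_def Complex_eq)

text \<open>
  The map \<open>quad_char w z\<close> is real linear, so it commutes with the componentwise integral
  as soon as the eight components are integrable; they are, each being the signal times a
  continuous function bounded by \<open>1\<close>.
\<close>

lemma quad_char_OFT:
  assumes u: "integrable lebesgue u"
  shows "quad_char w z (OFT (\<lambda>x. oct_of_real (u x)) f)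
    = (LINT x|lebesgue. u x *\<^sub>R kernel_char w z f x)"
proof -
  have int: "integrable lebesgue (\<lambda>x. u x * g x)"
    if g: "continuous_on UNIV g" and "\<And>x. \<bar>g x\<bar> \<le> 1" for g :: "real^3 \<Rightarrow> real"
  proof -
    have "g \<in> borel_measurable lebesgue"
      using borel_measurable_continuous_onI[OF g] by (intro measurable_completion) simp
    from integrable_mult_bounded[OF u this, of 1] that show ?thesis by simp
  qed
  have scale: "quad_char w z (r *\<^sub>R p) = r *\<^sub>R quad_char w z p" for r p
    by (simp add: quad_char_def quad_of_oct_def scaleR_octonion_def scaleR_quaternion_def
        complex_eq_iff algebra_simps)
  have "quad_char w z (oct_integral lebesgue (\<lambda>x. u x *\<^sub>R OFT_kernel f x))
      = (LINT x|lebesgue. quad_char w z (u x *\<^sub>R OFT_kernel f x))"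
    by (rule quad_char_integral;
        simp del: cos_minus sin_minus add: scaleR_octonion_def scaleR_quaternion_def
          OFT_kernel_def oct_of_quad_def Let_def;
        rule int, (intro continuous_intros; fail), simp add: abs_mult mult_le_one)
  then show ?thesis
    by (simp add: OFT_def OFT_integrand kernel_char_def scale)
qed

theorem corollary7:
  fixes u h v :: "real^3 \<Rightarrow> real"
  assumes "integrable lebesgue u"
    and "integrable lebesgue h"
    and "\<And>x. v x = (LINT y|lebesgue. u y * h (x - y))"
  shows "\<forall>f. OFT (\<lambda>x. oct_of_real (v x)) f
    = OFT (\<lambda>x. oct_of_real (h x)) f \<odot> OFT (\<lambda>x. oct_of_real (u x)) f"
proof
  fix f :: "real^3"
  show "OFT (\<lambda>x. oct_of_real (v x)) f
    = OFT (\<lambda>x. oct_of_real (h x)) f \<odot> OFT (\<lambda>x. oct_of_real (u x)) f"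
  proof (rule quad_char_eqI)
    fix w z :: complex
    assume "w \<in> {\<i>, -\<i>}" and "z \<in> {\<i>, -\<i>}"
    then have w: "w * w = -1" and z: "z * z = -1" by auto
    note conv = convolution_character[OF assms(1,2) borel_kernel_char[of w z f]
        norm_kernel_char_le kernel_char_add[OF w z], folded assms(3)]
    show "quad_char w z (OFT (\<lambda>x. oct_of_real (v x)) f)
      = quad_char w z (OFT (\<lambda>x. oct_of_real (h x)) f \<odot> OFT (\<lambda>x. oct_of_real (u x)) f)"
      using conv(2)
      by (simp add: quad_char_mult[OF w z] quad_char_OFT conv(1) assms(1,2))
  qed
qed

end
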